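(* Let $\Pi^{(0)}$ and $\Pi^{(i)}$ ($i=1,\dots,I$) be independent exchangeable random partitions of $\mathbb{N}$ such that, as $n\to+\infty$, $|\Pi^{(0)}_n|/a_n$ converges almost surely to a strictly positive random variable $D^{(0)}_\infty$ and, for each $i=1,\dots,I$, $|\Pi^{(i)}_n|/b_n$ converges almost surely to a strictly positive random variable $D^{(i)}_\infty$, for suitable diverging sequences $a_n$ and $b_n$. Moreover assume that $a_n=n^{\sigma_0}L_0(n)$ and $b_n=n^{\sigma_1}L_1(n)$, with $\sigma_0,\sigma_1\ge0$ and $L_0,L_1$ slowly varying functions, and set $$d_n:=a_{b_n}=n^{\sigma_0\sigma_1}L_1(n)^{\sigma_0}L_0\big(n^{\sigma_1}L_1(n)\big),$$ where $a_x=x^{\sigma_0}L_0(x)$ for real $x>0$. For positive integers $n_1(t),\dots,n_I(t)$, $t=1,2,\dots$, let $n(t)=\sum_{i=1}^In_i(t)$, $K_{i,t}=|\Pi^{(i)}_{n_i(t)}|$, $K_t=\sum_{i=1}^IK_{i,t}$, $D_{i,t}=|\Pi^{(0)}_{K_{i,t}}|$ and $D_t=|\Pi^{(0)}_{K_t}|$. (i) If $\lim_{t\to+\infty}n_i(t)=+\infty$ for some $i$, then (for that $i$), as $t\to+\infty$, $$\frac{D_{i,t}}{d_{n_i(t)}}\to D^{(0)}_\infty\big(D^{(i)}_\infty\big)^{\sigma_0}\quad\text{a.s.}$$ (ii) If $\lim_{t\to+\infty}n_i(t)=+\infty$ and $n_i(t)/n(t)\to w_i>0$ for every $i=1,\dots,I$,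 then, as $t\to+\infty$, $$\frac{D_t}{d_{n(t)}}\to D^{(0)}_\infty\Big(\sum_{i=1}^Iw_i^{\sigma_1}D^{(i)}_\infty\Big)^{\sigma_0}\quad\text{a.s.}$$
   Context: A random partition of $\mathbb{N}$ is a sequence $\Pi=(\Pi_n)_{n\ge1}$ with $\Pi_n$ a random partition of $\{1,\dots,n\}$, consistent under restriction ($\Pi_m$ is the restriction of $\Pi_n$ to $\{1,\dots,m\}$ for $m<n$); $|\Pi_n|$ is its number of blocks. It is exchangeable if the law of each $\Pi_n$ is invariant under permutations of $\{1,\dots,n\}$. A slowly varying function is a measurable function $L:(0,\infty)\to(0,\infty)$ (it suffices that it be defined and positive for large arguments) with $L(cx)/L(x)\to1$ as $x\to+\infty$ for every $c>0$. A "diverging" sequence is one tending to $+\infty$. *)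

theory Defs
  imports "HOL-Probability.Probability" "HOL-Combinatorics.Permutations" "HOL-Library.Disjoint_Sets"
begin

definition partitions :: "nat \<Rightarrow> nat set set set" where
  "partitions n = {P. partition_on {1..n} P}"

text \<open>
  A sequence of partitions is a function on all of \<^typ>\<open>nat\<close>. The component at \<open>0\<close> carries no
  information: the only partition of the empty set is the empty one.
\<close>

definition partition_space :: "(nat \<Rightarrow> nat set set) measure" where
  "partition_space = (\<Pi>\<^sub>M n\<in>UNIV. count_space (partitions n))"

definition restrict_partition :: "nat \<Rightarrow> nat set set \<Rightarrow> nat set set" where
  "restrict_partition m P = (\<lambda>B. B \<inter> {1..m}) ` P - {{}}"

definition permute_partition :: "(nat \<Rightarrow> nat) \<Rightarrow> nat set set \<Rightarrow> nat set set" where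
  "permute_partition p P = (\<lambda>B. p ` B) ` P"

definition random_partition :: "'a measure \<Rightarrow> ('a \<Rightarrow> nat \<Rightarrow> nat set set) \<Rightarrow> bool" where
  "random_partition M X \<longleftrightarrow>
     X \<in> measurable M partition_space \<and>
     (\<forall>\<omega>\<in>space M. \<forall>m n. m < n \<longrightarrow> X \<omega> m = restrict_partition m (X \<omega> n))"

definition exchangeable_partition :: "'a measure \<Rightarrow> ('a \<Rightarrow> nat \<Rightarrow> nat set set) \<Rightarrow> bool" where
  "exchangeable_partition M X \<longleftrightarrow>
     random_partition M X \<and>
     (\<forall>n p. p permutes {1..n} \<longrightarrow>
        distr M (count_space (partitions n)) (\<lambda>\<omega>. permute_partition p (X \<omega> n)) =
        distr M (count_space (partitions n)) (\<lambda>\<omega>. X \<omega> n))"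

text \<open>
  Only the behaviour of \<open>L\<close> for large arguments matters, so positivity and measurability are
  required only on some half-line. A function that is measurable and positive on all of
  \<open>(0, \<infinity>)\<close> qualifies.
\<close>

definition slowly_varying :: "(real \<Rightarrow> real) \<Rightarrow> bool" where
  "slowly_varying L \<longleftrightarrow>
     (\<exists>x0>0. L \<in> borel_measurable (restrict_space borel {x0..}) \<and> (\<forall>x\<ge>x0. 0 < L x)) \<and>
     (\<forall>c>0. ((\<lambda>x. L (c * x) / L x) \<longlongrightarrow> 1) at_top)"

lemma space_partition_space: "space partition_space = {X. \<forall>n. partition_on {1..n} (X n)}"
  by (auto simp: partition_space_def partitions_def space_PiM PiE_def Pi_def)

lemma slowly_varyingI_pos:
  assumes "L \<in> borel_measurable (restrict_space borel {0<..})" "\<And>x. x > 0 \<Longrightarrow> 0 < L x"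
    and "\<And>c. c > 0 \<Longrightarrow> ((\<lambda>x. L (c * x) / L x) \<longlongrightarrow> 1) at_top"
  shows "slowly_varying L"
proof -
  have "L \<in> borel_measurable (restrict_space borel {1..})"
    by (rule measurable_restrict_mono[OF assms(1)]) auto
  then show ?thesis
    using assms(2,3) by (auto simp: slowly_varying_def intro!: exI[of _ 1])
qed

lemma composed_rate_eq:
  fixes n \<sigma>0 \<sigma>1 :: real
  assumes "n > 0" "L1 n > 0"
  shows "(n powr \<sigma>1 * L1 n) powr \<sigma>0 * L0 (n powr \<sigma>1 * L1 n) =
    n powr (\<sigma>0 * \<sigma>1) * L1 n powr \<sigma>0 * L0 (n powr \<sigma>1 * L1 n)"
  using assms by (simp add: powr_mult powr_powr mult.commute)

end

theory Submission
  imports Defs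
begin

text \<open>
  Almost surely the claim is a deterministic statement about regularly varying functions: if
  \<open>f x = x powr \<sigma> * L x\<close> with \<open>L\<close> slowly varying, \<open>x\<^sub>t \<rightarrow> \<infinity>\<close> and \<open>y\<^sub>t / x\<^sub>t \<rightarrow> c > 0\<close>, then
  \<open>f y\<^sub>t / f x\<^sub>t \<rightarrow> c powr \<sigma>\<close>. This is the uniform convergence theorem for slowly varying functions.
  In additive form, with \<open>h = ln \<circ> L \<circ> exp\<close>, put \<open>y\<^sub>t = x\<^sub>t + u\<^sub>t\<close> with \<open>u\<^sub>t\<close> bounded. The sets of
  \<open>s \<in> [0, T]\<close> with \<open>h (x\<^sub>t + s) \<approx> h x\<^sub>t\<close>, and with \<open>h (y\<^sub>t + s) \<approx> h y\<^sub>t\<close>, have measure tending to \<open>T\<close>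
  by dominated convergence. For \<open>T\<close> large the second set shifted by \<open>u\<^sub>t\<close> must meet the first one,
  and at a common point \<open>h x\<^sub>t\<close> and \<open>h y\<^sub>t\<close> are both close to the same value.
\<close>

section \<open>Uniform convergence in additive form\<close>

lemma measure_close_shifts_tendsto:
  fixes h :: "real \<Rightarrow> real" and x :: "nat \<Rightarrow> real"
  assumes h[measurable]: "h \<in> borel_measurable borel"
    and sv: "\<And>u. ((\<lambda>x. h (x + u) - h x) \<longlongrightarrow> 0) at_top"
    and x: "filterlim x at_top sequentially"
    and "e > 0" "T \<ge> 0"
  shows "(\<lambda>n. measure lborel {s\<in>{0..T}. \<bar>h (x n + s) - h (x n)\<bar> < e}) \<longlonglongrightarrow> T"
proof -
  let ?A = "\<lambda>n. {s\<in>{0..T}. \<bar>h (x n + s) - h (x n)\<bar> < e}"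
  have A[measurable]: "?A n \<in> sets lborel" for n
    by measurable
  have "(\<lambda>n. integral\<^sup>L lborel (indicat_real (?A n))) \<longlonglongrightarrow> integral\<^sup>L lborel (indicat_real {0..T})"
  proof (rule integral_dominated_convergence[where w = "indicat_real {0..T}"])
    show "AE s in lborel. (\<lambda>n. indicat_real (?A n) s) \<longlonglongrightarrow> indicat_real {0..T} s"
    proof (rule AE_I2)
      fix s :: real
      have "(\<lambda>n. h (x n + s) - h (x n)) \<longlonglongrightarrow> 0"
        using filterlim_compose[OF sv x] .
      then have "\<forall>\<^sub>F n in sequentially. \<bar>h (x n + s) - h (x n)\<bar> < e"
        using \<open>e > 0\<close> by (auto simp: tendsto_iff)
      then have "\<forall>\<^sub>F n in sequentially. indicat_real (?A n) s = indicat_real {0..T} s"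
        by eventually_elim (auto simp: indicator_def)
      then show "(\<lambda>n. indicat_real (?A n) s) \<longlonglongrightarrow> indicat_real {0..T} s"
        by (rule tendsto_eventually)
    qed
  qed (auto simp: indicator_def emeasure_lborel_Icc_eq intro!: integrable_real_indicator)
  then show ?thesis
    using \<open>T \<ge> 0\<close> by simp
qed

lemma additive_uniform_convergence:
  fixes h :: "real \<Rightarrow> real" and x u :: "nat \<Rightarrow> real"
  assumes h[measurable]: "h \<in> borel_measurable borel"
    and sv: "\<And>u. ((\<lambda>x. h (x + u) - h x) \<longlongrightarrow> 0) at_top"
    and x: "filterlim x at_top sequentially"
    and u: "\<And>n. \<bar>u n\<bar> \<le> U"
  shows "(\<lambda>n. h (x n + u n) - h (x n)) \<longlonglongrightarrow> 0"
proof (rule tendstoI)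
  fix e :: real assume "e > 0"
  \<comment> \<open>After the shift both sets lie in an interval of length \<open>T + 2 * U\<close>,
    while their measures add up to nearly \<open>2 * T\<close>. They must overlap as soon as
    \<open>T > 2 * U\<close>, which the extra 1 secures.\<close>
  define T where "T = 2 * U + 1"
  have "U \<ge> 0" using u[of 0] by linarith
  define y where "y = (\<lambda>n. x n + u n)"
  define A where "A = (\<lambda>z. {s\<in>{0..T}. \<bar>h (z + s) - h z\<bar> < e / 2})"
  have A[measurable]: "A z \<in> sets borel" for z
    unfolding A_def by measurable
  have "filterlim (\<lambda>n. - U + x n) at_top sequentially"
    by (rule filterlim_tendsto_add_at_top[OF tendsto_const x])
  then have y: "filterlim y at_top sequentially"
    by (rule filterlim_at_top_mono) (use u in \<open>auto simp: y_def abs_le_iff minus_le_iff\<close>)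
  have lim: "(\<lambda>n. measure lborel (A (z n))) \<longlonglongrightarrow> T" if "filterlim z at_top sequentially" for z
    unfolding A_def using measure_close_shifts_tendsto[OF h sv that, of "e/2" T] \<open>e > 0\<close> \<open>U \<ge> 0\<close>
    by (simp add: T_def)
  have "(\<lambda>n. measure lborel (A (x n)) + measure lborel (A (y n))) \<longlonglongrightarrow> T + T"
    by (intro tendsto_add lim x y)
  then have "\<forall>\<^sub>F n in sequentially. measure lborel (A (x n)) + measure lborel (A (y n)) > T + 2 * U"
    by (rule order_tendstoD) (simp add: T_def)
  then show "\<forall>\<^sub>F n in sequentially. dist (h (x n + u n) - h (x n)) 0 < e"
  proof eventually_elim
    case (elim n)
    \<comment> \<open>\<open>B\<close> is \<open>A (y n)\<close> translated by \<open>u n\<close>.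
      For \<open>s\<close> in \<open>B\<close> the point \<open>y n + (s - u n)\<close> is
      \<open>x n + s\<close>, so \<open>A (x n)\<close> and \<open>B\<close> both refer to the value
      of \<open>h\<close> at the same point.\<close>
    define B where "B = (\<lambda>s. s - u n) -` A (y n)"
    have B[measurable]: "B \<in> sets borel"
      unfolding B_def using measurable_sets_borel[of "\<lambda>s. s - u n" borel] A by measurable
    have "measure lborel B = measure lborel (A (y n))"
    proof -
      have "measure lborel (A (y n)) = measure (distr lborel borel ((+) (- u n))) (A (y n))"
        by (simp only: lborel_distr_plus)
      also have "\<dots> = measure lborel B"
        by (subst measure_distr) (auto simp: B_def intro!: arg_cong[where f = "measure lborel"])
      finally show ?thesis by simp
    qed
    have sub: "A (x n) \<union> B \<subseteq> {-U..T + U}"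
      using u[of n] \<open>U \<ge> 0\<close> by (auto simp: A_def B_def abs_le_iff)
    have fin: "emeasure lborel C \<noteq> \<infinity>" if "C \<subseteq> {-U..T + U}" "C \<in> sets borel" for C
      using emeasure_mono[OF that(1), of lborel] by (auto simp: top_unique emeasure_lborel_Icc_eq)
    have "A (x n) \<inter> B \<noteq> {}"
    proof
      assume "A (x n) \<inter> B = {}"
      then have "measure lborel (A (x n)) + measure lborel B = measure lborel (A (x n) \<union> B)"
        using sub fin by (intro measure_Union[symmetric]) auto
      also have "\<dots> \<le> measure lborel {-U..T + U}"
        using sub fin by (intro measure_mono_fmeasurable fmeasurableI) (auto simp: less_top)
      also have "\<dots> = T + 2 * U"
        using \<open>U \<ge> 0\<close> by (simp add: T_def)
      finally show False
        using elim \<open>measure lborel B = _\<close> by simp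
    qed
    then obtain s where "s \<in> A (x n)" "s - u n \<in> A (y n)"
      by (auto simp: B_def)
    then have "\<bar>h (x n + s) - h (x n)\<bar> < e / 2" "\<bar>h (x n + s) - h (y n)\<bar> < e / 2"
      by (auto simp: A_def y_def)
    then show ?case
      unfolding y_def dist_real_def by linarith
  qed
qed

section \<open>Slowly and regularly varying functions along sequences\<close>

lemma slowly_varying_eventually_pos:
  assumes "slowly_varying L"
  shows "\<forall>\<^sub>F x in at_top. 0 < L x"
  using assms unfolding slowly_varying_def eventually_at_top_linorder by blast

text \<open>Taking logarithms of argument and value turns the factor \<open>c n\<close> into the
  shift \<open>ln (c n)\<close>, which is at most \<open>U\<close> in absolute value, so the
  additive form applies.\<close>

lemma slowly_varying_uniform_convergence:
  fixes x c :: "nat \<Rightarrow> real"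
  assumes L: "slowly_varying L" and x: "filterlim x at_top sequentially"
    and c: "\<And>n. exp (- U) \<le> c n" "\<And>n. c n \<le> exp U"
  shows "(\<lambda>n. L (c n * x n) / L (x n)) \<longlonglongrightarrow> 1"
proof -
  obtain x0 where x0: "x0 > 0" "L \<in> borel_measurable (restrict_space borel {x0..})"
    "\<And>x. x \<ge> x0 \<Longrightarrow> 0 < L x" and
    sv: "\<And>c. c > 0 \<Longrightarrow> ((\<lambda>x. L (c * x) / L x) \<longlongrightarrow> 1) at_top"
    using L unfolding slowly_varying_def by blast
  \<comment> \<open>\<open>L\<close> is controlled only on \<open>{x0..}\<close>, whereas the
    additive form asks for measurability on the whole line. The value 1 below \<open>x0\<close>
    keeps \<open>L'\<close> positive and cannot affect a limit at infinity.\<close>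
  define L' where "L' = (\<lambda>x. if x \<in> {x0..} then L x else 1)"
  have [measurable]: "L' \<in> borel_measurable borel"
    unfolding L'_def using x0(2)
    by (subst measurable_If_restrict_space_iff) (simp_all add: atLeast_def)
  have L'_pos: "L' z > 0" for z
    using x0(3) by (simp add: L'_def)
  define h where "h = (\<lambda>z. ln (L' (exp z)))"
  have h_meas: "h \<in> borel_measurable borel"
    unfolding h_def by measurable
  have h_sv: "((\<lambda>z. h (z + u) - h z) \<longlongrightarrow> 0) at_top" for u
  proof -
    have "((\<lambda>z. ln (L (exp u * exp z) / L (exp z))) \<longlongrightarrow> ln 1) at_top"
      by (intro tendsto_ln filterlim_compose[OF sv exp_at_top]) auto
    moreover have "\<forall>\<^sub>F z in at_top. ln (L (exp u * exp z) / L (exp z)) = h (z + u) - h z"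
      using eventually_ge_at_top[of "ln x0"] eventually_ge_at_top[of "ln x0 - u"]
    proof eventually_elim
      case (elim z)
      then have "exp (ln x0) \<le> exp z" "exp (ln x0) \<le> exp (u + z)"
        by simp_all
      then have "exp z \<ge> x0" "exp u * exp z \<ge> x0"
        using x0(1) by (simp_all add: exp_add)
      then show ?case
        using x0(3)[of "exp z"] x0(3)[of "exp u * exp z"]
        by (simp add: h_def L'_def ln_div exp_add mult.commute)
    qed
    ultimately show ?thesis
      by (auto intro: Lim_transform_eventually)
  qed
  have c_pos: "c n > 0" for n
    using c(1)[of n] exp_gt_zero[of "-U"] by linarith
  have "(\<lambda>n. h (ln (x n) + ln (c n)) - h (ln (x n))) \<longlonglongrightarrow> 0"
  proof (rule additive_uniform_convergence[OF h_meas h_sv filterlim_compose[OF ln_at_top x]])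
    show "\<bar>ln (c n)\<bar> \<le> U" for n
      using c[of n] c_pos[of n]
      by (smt (verit) exp_gt_zero ln_exp ln_le_cancel_iff)
  qed
  then have "(\<lambda>n. exp (h (ln (x n) + ln (c n)) - h (ln (x n)))) \<longlonglongrightarrow> exp 0"
    by (rule tendsto_exp)
  moreover have "\<forall>\<^sub>F n in sequentially.
      exp (h (ln (x n) + ln (c n)) - h (ln (x n))) = L (c n * x n) / L (x n)"
    \<comment> \<open>The second bound leaves room for the smallest admissible factor
      \<open>exp (- U)\<close>: it keeps \<open>c n * x n\<close> in the region where
      \<open>L'\<close> is \<open>L\<close>.\<close>
    using x[unfolded filterlim_at_top, rule_format, of "max x0 (x0 * exp U)"]
  proof eventually_elim
    case (elim n)
    then have "x n \<ge> x0" "x n \<ge> x0 * exp U" by auto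
    have "x n > 0" using \<open>x n \<ge> x0\<close> x0(1) by simp
    have "x0 = exp (- U) * (x0 * exp U)"
      by (simp flip: exp_add add: mult_ac)
    also have "\<dots> \<le> c n * x n"
      using c(1)[of n] \<open>x n \<ge> x0 * exp U\<close> x0(1) c_pos[of n] by (intro mult_mono) auto
    finally have "c n * x n \<ge> x0" .
    then show ?case
      using \<open>x n > 0\<close> \<open>x n \<ge> x0\<close> c_pos[of n] L'_pos
      by (simp add: h_def exp_diff exp_add) (simp add: L'_def mult.commute)
  qed
  ultimately show ?thesis
    by (auto intro: Lim_transform_eventually)
qed

text \<open>The quotient splits into \<open>(y n / x n) powr \<sigma>\<close> and a quotient of
  values of \<open>L\<close>. Since \<open>y n / x n\<close> varies with \<open>n\<close>, the limit
  1 of the latter comes from uniform convergence, not from slow variation at one fixed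
  factor.\<close>

lemma regularly_varying_tendsto:
  fixes x y :: "nat \<Rightarrow> real"
  assumes L: "slowly_varying L" and f: "\<And>x. 0 < x \<Longrightarrow> f x = x powr \<sigma> * L x"
    and x: "filterlim x at_top sequentially"
    and yx: "(\<lambda>n. y n / x n) \<longlonglongrightarrow> c" and "c > 0"
  shows "(\<lambda>n. f (y n) / f (x n)) \<longlonglongrightarrow> c powr \<sigma>"
proof -
  \<comment> \<open>With this \<open>U\<close>, \<open>c\<close> lies strictly between
    \<open>exp (-U)\<close> and \<open>exp U\<close>. Clamping the quotient to that range gives
    bounds for every \<open>n\<close> and changes it for only finitely many
    \<open>n\<close>.\<close>
  define U where "U = \<bar>ln c\<bar> + 1"
  define r where "r = (\<lambda>n. max (exp (-U)) (min (exp U) (y n / x n)))"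
  have "exp (-U) < exp (ln c)" "exp (ln c) < exp U"
    unfolding exp_less_cancel_iff U_def by linarith+
  then have U: "exp (-U) < c" "c < exp U"
    using \<open>c > 0\<close> by simp_all
  have ev: "\<forall>\<^sub>F n in sequentially. r n = y n / x n"
    using order_tendstoD(1)[OF yx U(1)] order_tendstoD(2)[OF yx U(2)]
    by eventually_elim (simp add: r_def)
  have "(\<lambda>n. L (r n * x n) / L (x n)) \<longlonglongrightarrow> 1"
    by (intro slowly_varying_uniform_convergence[OF L x, of U]) (auto simp: r_def U_def)
  moreover have "(\<lambda>n. (y n / x n) powr \<sigma>) \<longlonglongrightarrow> c powr \<sigma>"
    using yx \<open>c > 0\<close> by (intro tendsto_powr) auto
  ultimately have "(\<lambda>n. (y n / x n) powr \<sigma> * (L (r n * x n) / L (x n))) \<longlonglongrightarrow> c powr \<sigma> * 1"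
    by (intro tendsto_mult)
  moreover have "\<forall>\<^sub>F n in sequentially.
      (y n / x n) powr \<sigma> * (L (r n * x n) / L (x n)) = f (y n) / f (x n)"
    using ev order_tendstoD(1)[OF yx \<open>c > 0\<close>] x[unfolded filterlim_at_top_dense, rule_format, of 0]
  proof eventually_elim
    case (elim n)
    then have "y n > 0" by (simp add: zero_less_divide_iff)
    then show ?case
      using elim by (simp add: f powr_divide)
  qed
  ultimately show ?thesis
    by (auto intro: Lim_transform_eventually)
qed

text \<open>The deterministic core of both limits: \<open>N (K t) / a (\<beta> t)\<close> is
  \<open>N (K t) / a (K t)\<close> times \<open>a (K t) / a (\<beta> t)\<close>. The first factor
  follows the limit of \<open>N\<close> along \<open>K\<close>, the second is regular variation of
  \<open>a\<close>.\<close>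

lemma subsequence_of_regularly_varying_tendsto:
  fixes K :: "nat \<Rightarrow> nat" and \<beta> N :: "nat \<Rightarrow> real"
  assumes L: "slowly_varying L" and a: "\<And>x. 0 < x \<Longrightarrow> a x = x powr \<sigma> * L x"
    and N: "(\<lambda>k. N k / a (real k)) \<longlonglongrightarrow> D"
    and \<beta>: "filterlim \<beta> at_top sequentially"
    and K: "(\<lambda>t. real (K t) / \<beta> t) \<longlonglongrightarrow> c" and "c > 0"
  shows "(\<lambda>t. N (K t) / a (\<beta> t)) \<longlonglongrightarrow> D * c powr \<sigma>"
proof -
  \<comment> \<open>\<open>K\<close> inherits divergence from \<open>\<beta>\<close> because their
    quotient has a positive limit.\<close>
  have "filterlim (\<lambda>t. real (K t) / \<beta> t * \<beta> t) at_top sequentially"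
    by (rule filterlim_tendsto_pos_mult_at_top[OF K \<open>c > 0\<close> \<beta>])
  moreover have "\<forall>\<^sub>F t in sequentially. real (K t) / \<beta> t * \<beta> t = real (K t)"
    using \<beta>[unfolded filterlim_at_top_dense, rule_format, of 0] by eventually_elim simp
  ultimately have K_real: "filterlim (\<lambda>t. real (K t)) at_top sequentially"
    by (simp cong: filterlim_cong)
  then have K_top: "filterlim K at_top sequentially"
    by (simp add: filterlim_sequentially_iff_filterlim_real)
  have "(\<lambda>t. N (K t) / a (real (K t)) * (a (real (K t)) / a (\<beta> t))) \<longlonglongrightarrow> D * c powr \<sigma>"
    by (intro tendsto_mult filterlim_compose[OF N K_top]
        regularly_varying_tendsto[OF L a \<beta> K \<open>c > 0\<close>])
  moreover have "\<forall>\<^sub>F t in sequentially.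
      N (K t) / a (real (K t)) * (a (real (K t)) / a (\<beta> t)) = N (K t) / a (\<beta> t)"
    using eventually_compose_filterlim[OF slowly_varying_eventually_pos[OF L] K_real]
      K_real[unfolded filterlim_at_top_dense, rule_format, of 0]
    by eventually_elim (simp add: a)
  ultimately show ?thesis
    by (rule Lim_transform_eventually)
qed

section \<open>Almost sure limits of \<open>D\<close> and \<open>Dtot\<close>\<close>

theorem proposition9:
  fixes M :: "'a measure"
    and I :: nat
    and X :: "nat \<Rightarrow> 'a \<Rightarrow> nat \<Rightarrow> nat set set"
    and Dinf :: "nat \<Rightarrow> 'a \<Rightarrow> real"
    and L0 L1 :: "real \<Rightarrow> real"
    and \<sigma>0 \<sigma>1 :: real
    and a :: "real \<Rightarrow> real"
    and b d :: "nat \<Rightarrow> real"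
    and ns :: "nat \<Rightarrow> nat \<Rightarrow> nat"
    and n :: "nat \<Rightarrow> nat"
    and w :: "nat \<Rightarrow> real"
    and K :: "nat \<Rightarrow> nat \<Rightarrow> 'a \<Rightarrow> nat"
    and Ktot :: "nat \<Rightarrow> 'a \<Rightarrow> nat"
    and D :: "nat \<Rightarrow> nat \<Rightarrow> 'a \<Rightarrow> nat"
    and Dtot :: "nat \<Rightarrow> 'a \<Rightarrow> nat"
  assumes "prob_space M"
    and "1 \<le> I"
    and "\<And>i. i \<in> {0..I} \<Longrightarrow> exchangeable_partition M (X i)"
    and "prob_space.indep_vars M (\<lambda>_. partition_space) X {0..I}"
    and "\<And>i. i \<in> {0..I} \<Longrightarrow> Dinf i \<in> borel_measurable M"
    and "\<And>i. i \<in> {0..I} \<Longrightarrow> AE \<omega> in M. 0 < Dinf i \<omega>"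
    and "0 \<le> \<sigma>0" and "0 \<le> \<sigma>1"
    and "slowly_varying L0" and "slowly_varying L1"
    and "\<And>x. 0 < x \<Longrightarrow> a x = x powr \<sigma>0 * L0 x"
    and "\<And>k. 1 \<le> k \<Longrightarrow> b k = real k powr \<sigma>1 * L1 (real k)"
    and "\<And>k. 1 \<le> k \<Longrightarrow> d k = a (b k)"
    and "filterlim (\<lambda>k. a (real k)) at_top sequentially"
    and "filterlim b at_top sequentially"
    and "AE \<omega> in M. (\<lambda>k. real (card (X 0 \<omega> k)) / a (real k)) \<longlonglongrightarrow> Dinf 0 \<omega>"
    and "\<And>i. i \<in> {1..I} \<Longrightarrow>
           AE \<omega> in M. (\<lambda>k. real (card (X i \<omega> k)) / b k) \<longlonglongrightarrow> Dinf i \<omega>"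
    and "\<And>i t. i \<in> {1..I} \<Longrightarrow> 1 \<le> t \<Longrightarrow> 1 \<le> ns i t"
    and "\<And>t. n t = (\<Sum>i=1..I. ns i t)"
    and "\<And>i t \<omega>. K i t \<omega> = card (X i \<omega> (ns i t))"
    and "\<And>t \<omega>. Ktot t \<omega> = (\<Sum>i=1..I. K i t \<omega>)"
    and "\<And>i t \<omega>. D i t \<omega> = card (X 0 \<omega> (K i t \<omega>))"
    and "\<And>t \<omega>. Dtot t \<omega> = card (X 0 \<omega> (Ktot t \<omega>))"
  shows "(\<forall>i\<in>{1..I}. filterlim (ns i) at_top sequentially \<longrightarrow>
            (AE \<omega> in M. (\<lambda>t. real (D i t \<omega>) / d (ns i t))
               \<longlonglongrightarrow> Dinf 0 \<omega> * Dinf i \<omega> powr \<sigma>0)) \<and>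
         ((\<forall>i\<in>{1..I}. filterlim (ns i) at_top sequentially \<and>
              (\<lambda>t. real (ns i t) / real (n t)) \<longlonglongrightarrow> w i \<and> 0 < w i) \<longrightarrow>
            (AE \<omega> in M. (\<lambda>t. real (Dtot t \<omega>) / d (n t))
               \<longlonglongrightarrow> Dinf 0 \<omega> * (\<Sum>i=1..I. w i powr \<sigma>1 * Dinf i \<omega>) powr \<sigma>0))"
proof (intro conjI ballI impI)
  note a = assms(11) and b = assms(12) and d = assms(13)
  note lim0 = assms(16) and limi = assms(17)
  {
    \<comment> \<open>Part (i): for a fixed outcome the core lemma is applied with scale
      \<open>b (ns i t)\<close> and limiting ratio \<open>Dinf i \<omega>\<close>.\<close>
    fix i assume i: "i \<in> {1..I}" and ns: "filterlim (ns i) at_top sequentially"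
    have "AE \<omega> in M. 0 < Dinf i \<omega>"
      using assms(6) i by simp
    with lim0 limi[OF i]
    show "AE \<omega> in M. (\<lambda>t. real (D i t \<omega>) / d (ns i t)) \<longlonglongrightarrow> Dinf 0 \<omega> * Dinf i \<omega> powr \<sigma>0"
    proof eventually_elim
      case (elim \<omega>)
      have "(\<lambda>t. real (card (X 0 \<omega> (K i t \<omega>))) / a (b (ns i t)))
          \<longlonglongrightarrow> Dinf 0 \<omega> * Dinf i \<omega> powr \<sigma>0"
        using elim(3) filterlim_compose[OF elim(2) ns] filterlim_compose[OF assms(15) ns]
        by (intro subsequence_of_regularly_varying_tendsto[OF \<open>slowly_varying L0\<close> a elim(1)])
          (simp_all add: assms(20))
      moreover have "\<forall>\<^sub>F t in sequentially.
          real (card (X 0 \<omega> (K i t \<omega>))) / a (b (ns i t)) = real (D i t \<omega>) / d (ns i t)"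
        using ns[unfolded filterlim_at_top, rule_format, of 1]
        by eventually_elim (simp add: d assms(22))
      ultimately show ?case
        by (rule Lim_transform_eventually)
    qed
  }
  \<comment> \<open>Part (ii): the core lemma is applied with scale \<open>b (n t)\<close>, once
    \<open>Ktot t \<omega> / b (n t)\<close> is known to have a positive limit.\<close>
  assume *: "\<forall>i\<in>{1..I}. filterlim (ns i) at_top sequentially \<and>
              (\<lambda>t. real (ns i t) / real (n t)) \<longlonglongrightarrow> w i \<and> 0 < w i"
  have n: "filterlim n at_top sequentially"
  proof (rule filterlim_at_top_mono)
    show "filterlim (ns 1) at_top sequentially"
      using * \<open>1 \<le> I\<close> by simp
    show "\<forall>\<^sub>F t in sequentially. ns 1 t \<le> n t"
      unfolding assms(19) using \<open>1 \<le> I\<close> by (intro always_eventually allI member_le_sum) auto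
  qed
  have n1: "\<forall>\<^sub>F t in sequentially. n t \<ge> 1"
    using n[unfolded filterlim_at_top] by blast
  have b_ratio: "(\<lambda>t. b (ns i t) / b (n t)) \<longlonglongrightarrow> w i powr \<sigma>1" if "i \<in> {1..I}" for i
  proof -
    \<comment> \<open>\<open>b\<close> is given only at positive integers; \<open>?f\<close> is its
      extension to real arguments, to which regular variation applies.\<close>
    let ?f = "\<lambda>x. x powr \<sigma>1 * L1 x"
    have ns1: "\<forall>\<^sub>F t in sequentially. ns i t \<ge> 1"
      using * that unfolding filterlim_at_top by blast
    have "(\<lambda>t. ?f (real (ns i t)) / ?f (real (n t))) \<longlonglongrightarrow> w i powr \<sigma>1"
      using * that
      by (intro regularly_varying_tendsto[OF \<open>slowly_varying L1\<close> refl
            filterlim_compose[OF filterlim_real_sequentially n]]) auto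
    moreover have "\<forall>\<^sub>F t in sequentially.
        ?f (real (ns i t)) / ?f (real (n t)) = b (ns i t) / b (n t)"
      using n1 ns1 by eventually_elim (simp add: b)
    ultimately show ?thesis
      by (rule Lim_transform_eventually)
  qed
  have b_nz: "\<forall>\<^sub>F k in sequentially. b k > 0"
    using assms(15) unfolding filterlim_at_top_dense by blast
  have "AE \<omega> in M. \<forall>i\<in>{1..I}. (\<lambda>k. real (card (X i \<omega> k)) / b k) \<longlonglongrightarrow> Dinf i \<omega>"
    by (rule AE_finite_allI) (use limi in auto)
  moreover have "AE \<omega> in M. \<forall>i\<in>{1..I}. 0 < Dinf i \<omega>"
    by (rule AE_finite_allI) (use assms(6) in auto)
  ultimately
  show "AE \<omega> in M. (\<lambda>t. real (Dtot t \<omega>) / d (n t))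
      \<longlonglongrightarrow> Dinf 0 \<omega> * (\<Sum>i=1..I. w i powr \<sigma>1 * Dinf i \<omega>) powr \<sigma>0"
    using lim0
  proof eventually_elim
    case (elim \<omega>)
    have K: "(\<lambda>t. real (K i t \<omega>) / b (n t)) \<longlonglongrightarrow> w i powr \<sigma>1 * Dinf i \<omega>"
      if i: "i \<in> {1..I}" for i
    proof -
      have ns: "filterlim (ns i) at_top sequentially" using * i by blast
      \<comment> \<open>Changing the scale from \<open>b (ns i t)\<close> to \<open>b (n t)\<close>
        costs the factor \<open>b (ns i t) / b (n t)\<close>, whence the weight
        \<open>w i powr \<sigma>1\<close>.\<close>
      have "(\<lambda>t. b (ns i t) / b (n t) * (real (K i t \<omega>) / b (ns i t)))
          \<longlonglongrightarrow> w i powr \<sigma>1 * Dinf i \<omega>"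
        unfolding assms(20) using elim(1) i
        by (intro tendsto_mult b_ratio filterlim_compose[OF _ ns]) auto
      moreover have "\<forall>\<^sub>F t in sequentially.
          b (ns i t) / b (n t) * (real (K i t \<omega>) / b (ns i t)) = real (K i t \<omega>) / b (n t)"
        using eventually_compose_filterlim[OF b_nz ns] by eventually_elim simp
      ultimately show ?thesis
        by (rule Lim_transform_eventually)
    qed
    have "(\<lambda>t. real (Ktot t \<omega>) / b (n t)) \<longlonglongrightarrow> (\<Sum>i=1..I. w i powr \<sigma>1 * Dinf i \<omega>)"
      unfolding assms(21) of_nat_sum sum_divide_distrib by (intro tendsto_sum K)
    \<comment> \<open>The index set is nonempty by \<open>1 \<le> I\<close>, so the sum of positive
      terms is positive.\<close>
    moreover have "(\<Sum>i=1..I. w i powr \<sigma>1 * Dinf i \<omega>) > 0"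
      using elim(2) * \<open>1 \<le> I\<close> by (intro sum_pos mult_pos_pos) (auto simp: less_le)
    ultimately have "(\<lambda>t. real (card (X 0 \<omega> (Ktot t \<omega>))) / a (b (n t)))
        \<longlonglongrightarrow> Dinf 0 \<omega> * (\<Sum>i=1..I. w i powr \<sigma>1 * Dinf i \<omega>) powr \<sigma>0"
      by (intro subsequence_of_regularly_varying_tendsto[OF \<open>slowly_varying L0\<close> a elim(3)]
          filterlim_compose[OF assms(15) n])
    moreover have "\<forall>\<^sub>F t in sequentially.
        real (card (X 0 \<omega> (Ktot t \<omega>))) / a (b (n t)) = real (Dtot t \<omega>) / d (n t)"
      using n1 by eventually_elim (simp add: d assms(23))
    ultimately show ?case
      by (rule Lim_transform_eventually)
  qed
qed

end
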